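(* Let $G$ be a graph with vertex set $\{v_1,\dots,v_n\}$ and size $m$. For $i=1,\dots,n$ let $G_i$ be an $r_i$-regular graph of order $n_i$ with adjacency eigenvalues $\lambda_{i1}=r_{i}\geq \lambda_{i2}\geq\dots\geq \lambda_{in_{i}}$, and let $\alpha_i=\sum_{v_j\in N_{G}(v_{i})}n_{j}$. Assume $r_i+\alpha_i>0$ for all $i$. Then the normalized Laplacian eigenvalues of the joined union $G[G_{1},\dots, G_{n}]$ consist of the eigenvalues $1-\frac{\lambda_{ik}}{r_{i}+\alpha_{i}}$ for $i=1,\dots,n$ and $k=2,\dots,n_{i}$, together with the $n$ eigenvalues of the $n\times n$ matrix whose $(i,i)$ entry is $\frac{\alpha_i}{\alpha_i+r_i}$ and whose $(i,j)$ entry, $i\ne j$, is $-\frac{n_j a_{ij}}{\sqrt{(r_i+\alpha_i)(r_j+\alpha_j)}}$, where $a_{ij}=1$ if $v_i\sim v_j$ in $G$ and $a_{ij}=0$ otherwise.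
   Context: The normalized Laplacian matrix of a graph with no isolated vertices is $\mathcal{L}=I-D^{-1/2}AD^{-1/2}$, where $A$ is the adjacency matrix and $D$ the diagonal degree matrix; its eigenvalues are the normalized Laplacian eigenvalues. $N_G(v_i)$ is the set of neighbours of $v_i$ in $G$. The joined union $G[G_1,\dots,G_n]$ is obtained from the disjoint union $G_1\cup\dots\cup G_n$ by joining every vertex of $G_i$ to every vertex of $G_j$ whenever $v_i\sim v_j$ in $G$. *)

theory Defs
  imports Complex_Main "Graph_Theory.Pair_Digraph" "Jordan_Normal_Form.Char_Poly"
begin

text \<open>
  A finite simple graph is a \<^locale>\<open>pair_graph\<close>: a finite, loopless, symmetric set of arcs
  given as pairs. An edge is a pair of opposite arcs, so the degree of a vertex is its
  \<^const>\<open>out_degree\<close>.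
\<close>

definition neighbourhood :: "'a pair_pre_digraph \<Rightarrow> 'a \<Rightarrow> 'a set" where
  "neighbourhood G v = {u. (v, u) \<in> parcs G}"

definition regular_graph :: "'a pair_pre_digraph \<Rightarrow> nat \<Rightarrow> bool" where
  "regular_graph G r \<longleftrightarrow> pair_graph G \<and> (\<forall>v \<in> pverts G. out_degree (with_proj G) v = r)"

definition enumerates :: "'a list \<Rightarrow> 'a pair_pre_digraph \<Rightarrow> bool" where
  "enumerates xs G \<longleftrightarrow> distinct xs \<and> set xs = pverts G"

text \<open>The matrices of a graph are taken with respect to an enumeration of its vertices.\<close>

definition adjacency_matrix :: "'a pair_pre_digraph \<Rightarrow> 'a list \<Rightarrow> real mat" where
  "adjacency_matrix G xs =
     mat (length xs) (length xs) (\<lambda>(p, q). if (xs ! p, xs ! q) \<in> parcs G then 1 else 0)"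

definition inv_sqrt_degree_matrix :: "'a pair_pre_digraph \<Rightarrow> 'a list \<Rightarrow> real mat" where
  "inv_sqrt_degree_matrix G xs =
     mat_diag (length xs) (\<lambda>p. 1 / sqrt (real (out_degree (with_proj G) (xs ! p))))"

text \<open>Meaningful only for graphs without isolated vertices, since \<^term>\<open>1 / sqrt 0 = 0\<close> in HOL.\<close>

definition normalized_laplacian :: "'a pair_pre_digraph \<Rightarrow> 'a list \<Rightarrow> real mat" where
  "normalized_laplacian G xs =
     1\<^sub>m (length xs) -
       inv_sqrt_degree_matrix G xs * adjacency_matrix G xs * inv_sqrt_degree_matrix G xs"

text \<open>
  All complex eigenvalues of a real square matrix, counted with algebraic multiplicity. No
  eigenvalue is lost for a matrix that is not symmetric.
\<close>

definition eigenvalues :: "real mat \<Rightarrow> complex multiset" where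
  "eigenvalues A = proots (char_poly (map_mat complex_of_real A))"

text \<open>
  The joined union of the graphs \<^term>\<open>Gs 0\<close>, \<open>\<dots>\<close>, \<^term>\<open>Gs (length vs - 1)\<close> over a graph
  \<^term>\<open>G\<close> with vertices enumerated by \<^term>\<open>vs\<close>. Disjointness comes from tagging each vertex of
  \<^term>\<open>Gs i\<close> with \<^term>\<open>i\<close>.
\<close>

definition joined_union ::
  "'v pair_pre_digraph \<Rightarrow> 'v list \<Rightarrow> (nat \<Rightarrow> 'a pair_pre_digraph) \<Rightarrow> (nat \<times> 'a) pair_pre_digraph"
where
  "joined_union G vs Gs =
     \<lparr> pverts = (SIGMA i:{..<length vs}. pverts (Gs i)),
       parcs =
         {((i, x), (i, y)) | i x y. i < length vs \<and> (x, y) \<in> parcs (Gs i)} \<union>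
         {((i, x), (j, y)) | i j x y. i < length vs \<and> j < length vs \<and> (vs ! i, vs ! j) \<in> parcs G \<and>
            x \<in> pverts (Gs i) \<and> y \<in> pverts (Gs j)} \<rparr>"

lemma pair_graph_joined_union:
  assumes G: "pair_graph G" and vs: "enumerates vs G"
    and Gs: "\<And>i. i < length vs \<Longrightarrow> pair_graph (Gs i)"
  shows "pair_graph (joined_union G vs Gs)"
proof -
  let ?J = "joined_union G vs Gs"
  have wf: "x \<in> pverts (Gs i) \<and> y \<in> pverts (Gs i) \<and> x \<noteq> y \<and> (y, x) \<in> parcs (Gs i)"
    if "i < length vs" "(x, y) \<in> parcs (Gs i)" for i x y
  proof -
    interpret pair_graph "Gs i" using Gs that(1) .
    show ?thesis
      using that(2) pair_no_loops[of "(x, y)"] pair_sym_arcs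
      by (auto simp: in_arcsD1 in_arcsD2 symmetric_def sym_def)
  qed
  have sym: "x \<noteq> y \<and> (y, x) \<in> parcs G" if "(x, y) \<in> parcs G" for x y
  proof -
    interpret pair_graph G using G .
    show ?thesis
      using that pair_no_loops[of "(x, y)"] pair_sym_arcs
      by (auto simp: symmetric_def sym_def)
  qed
  have sub: "parcs ?J \<subseteq> pverts ?J \<times> pverts ?J"
    by (auto simp: joined_union_def dest: wf)
  have fin: "finite (pverts ?J)"
    using pair_fin_digraph.pair_finite_verts[OF pair_digraph.axioms(1)[OF pair_graph.axioms(1)[OF Gs]]]
    by (auto simp: joined_union_def)
  show ?thesis
  proof unfold_locales
    show "finite (pverts ?J)" by fact
    show "finite (parcs ?J)"
      using sub fin by (meson finite_SigmaI finite_subset)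
    show "symmetric (with_proj ?J)"
      unfolding symmetric_def sym_def with_proj_simps
      by (auto simp: joined_union_def dest: wf sym)
  next
    fix e assume e: "e \<in> parcs ?J"
    show "fst e \<in> pverts ?J" "snd e \<in> pverts ?J" using e sub by auto
    show "fst e \<noteq> snd e" using e by (auto simp: joined_union_def dest: wf sym)
  qed
qed

lemma set_eigenvalues:
  assumes "A \<in> carrier_mat n n"
  shows "set_mset (eigenvalues A) = {k. eigenvalue (map_mat complex_of_real A) k}"
proof -
  have c: "map_mat complex_of_real A \<in> carrier_mat n n" using assms by simp
  have "char_poly (map_mat complex_of_real A) \<noteq> 0"
    using degree_monic_char_poly[OF c] by auto
  then show ?thesis
    unfolding eigenvalues_def using eigenvalue_root_char_poly[OF c] by simp
qed

end

theory Submission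
  imports Defs "Jordan_Normal_Form.Schur_Decomposition"
begin

text \<open>
  Write \<open>d\<^sub>i = r\<^sub>i + \<alpha>\<^sub>i\<close>. The normalized Laplacian is \<open>B + P K\<close>, where \<open>B\<close> is block diagonal with
  blocks \<open>I - A\<^sub>i / d\<^sub>i\<close>, \<open>P\<close> is the incidence matrix of vertices and parts, and \<open>K\<close> carries the
  joins. Regularity of the parts says that \<open>B P = P E\<close> for the diagonal matrix \<open>E\<close> with entries
  \<open>1 - r\<^sub>i / d\<^sub>i = \<alpha>\<^sub>i / d\<^sub>i\<close>, and \<open>E + K P\<close> is the quotient matrix of the theorem. Block elimination
  gives \<open>\<chi>(B + P K) \<chi>(E) = \<chi>(B) \<chi>(E + K P)\<close>, where the roots of \<open>\<chi>(E)\<close> cancel the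
  contributions of \<open>\<lambda>\<^sub>i\<^sub>1 = r\<^sub>i\<close> to \<open>\<chi>(B)\<close>. No eigenvectors are needed.
\<close>

section \<open>Characteristic polynomials\<close>

text \<open>Eliminating the block matrix \<open>?W\<close> in two ways gives its determinant as
  \<open>det (A - P * K)\<close> and, after multiplication by \<open>det E\<close>, as
  \<open>det A * det (E - K * P)\<close>. Right multiplication by \<open>?R\<close> takes the place
  of inverting \<open>A\<close>, so the identity can be applied to characteristic matrices over a
  polynomial ring, which are in general not invertible there.\<close>

lemma det_diff_intertwined:
  fixes A :: "'a :: idom mat"
  assumes A: "A \<in> carrier_mat m m" and P: "P \<in> carrier_mat m n"
    and K: "K \<in> carrier_mat n m" and E: "E \<in> carrier_mat n n"
    and AP: "A * P = P * E"
  shows "det (A - P * K) * det E = det A * det (E - K * P)"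
proof -
  \<comment> \<open>Multiplying \<open>?W\<close> by \<open>?L\<close> clears the lower left block, multiplying it by \<open>?R\<close> the upper
    right one (by \<open>A P = P E\<close>).\<close>
  let ?W = "four_block_mat A P K (1\<^sub>m n)"
  let ?L = "four_block_mat (1\<^sub>m m) (0\<^sub>m m n) (- K) (1\<^sub>m n)"
  let ?R = "four_block_mat (1\<^sub>m m) (- P) (0\<^sub>m n m) E"
  note car = A P K E mult_carrier_mat[OF P K] mult_carrier_mat[OF K P] mult_carrier_mat[OF P E]
  have W: "?W \<in> carrier_mat (m + n) (m + n)" and L: "?L \<in> carrier_mat (m + n) (m + n)"
    and R: "?R \<in> carrier_mat (m + n) (m + n)"
    using A E by auto
  have "?W * ?L = four_block_mat (A * 1\<^sub>m m + P * (- K)) (A * 0\<^sub>m m n + P * 1\<^sub>m n)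
      (K * 1\<^sub>m m + 1\<^sub>m n * (- K)) (K * 0\<^sub>m m n + 1\<^sub>m n * 1\<^sub>m n)"
    by (rule mult_four_block_mat) (use car in auto)
  also have "A * 1\<^sub>m m + P * (- K) = A - P * K"
    using car by (simp add: uminus_mult_right_mat add_uminus_minus_mat)
  also have "A * 0\<^sub>m m n + P * 1\<^sub>m n = P"
    using car by simp
  also have "K * 1\<^sub>m m + 1\<^sub>m n * (- K) = 0\<^sub>m n m"
    using car by (simp add: add_uminus_minus_mat)
  also have "K * 0\<^sub>m m n + 1\<^sub>m n * 1\<^sub>m n = 1\<^sub>m n"
    using car by simp
  finally have "det (?W * ?L) = det (A - P * K) * det (1\<^sub>m n :: 'a mat)"
    by (simp only:) (rule det_four_block_mat_lower_left_zero[of _ m _ n], use car in auto)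
  moreover have "det ?L = det (1\<^sub>m m :: 'a mat) * det (1\<^sub>m n :: 'a mat)"
    by (rule det_four_block_mat_upper_right_zero[of _ m _ n]) (use car in auto)
  ultimately have 1: "det ?W = det (A - P * K)"
    using det_mult[OF W L] by simp
  have "?W * ?R = four_block_mat (A * 1\<^sub>m m + P * 0\<^sub>m n m) (A * (- P) + P * E)
      (K * 1\<^sub>m m + 1\<^sub>m n * 0\<^sub>m n m) (K * (- P) + 1\<^sub>m n * E)"
    by (rule mult_four_block_mat) (use car in auto)
  also have "A * 1\<^sub>m m + P * 0\<^sub>m n m = A"
    using car by simp
  also have "A * (- P) + P * E = 0\<^sub>m m n"
    using car by (simp add: uminus_mult_right_mat AP uminus_l_inv_mat)
  also have "K * 1\<^sub>m m + 1\<^sub>m n * 0\<^sub>m n m = K"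
    using car by simp
  also have "K * (- P) + 1\<^sub>m n * E = E - K * P"
    using car by (simp add: uminus_mult_right_mat comm_add_mat[of "- (K * P)" n n E] add_uminus_minus_mat)
  finally have "det (?W * ?R) = det A * det (E - K * P)"
    by (simp only:) (rule det_four_block_mat_upper_right_zero[of _ m _ n], use car in auto)
  moreover have "det ?R = det (1\<^sub>m m :: 'a mat) * det E"
    by (rule det_four_block_mat_lower_left_zero[of _ m _ n]) (use car in auto)
  ultimately show ?thesis
    using det_mult[OF W R] 1 by simp
qed

text \<open>The scalar matrix X I commutes past \<open>P\<close>, so the intertwining relation
  passes from \<open>A\<close> and \<open>E\<close> to X I - A and X I - E. The determinant identity
  then applies over the polynomial ring, with \<open>P\<close> and \<open>K\<close> embedded as
  constant matrices.\<close>

lemma char_poly_add_intertwined: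
  fixes A :: "'a :: idom mat"
  assumes A: "A \<in> carrier_mat m m" and P: "P \<in> carrier_mat m n"
    and K: "K \<in> carrier_mat n m" and E: "E \<in> carrier_mat n n"
    and AP: "A * P = P * E"
  shows "char_poly (A + P * K) * char_poly E = char_poly A * char_poly (E + K * P)"
proof -
  let ?c = "map_mat (\<lambda>a. [:a:]) :: 'a mat \<Rightarrow> 'a poly mat"
  let ?X = "[:0, 1:] :: 'a poly"
  interpret c: comm_ring_hom "\<lambda>a::'a. [:a:]"
    by unfold_locales (auto simp: one_pCons)
  have cp: "char_poly_matrix B = ?X \<cdot>\<^sub>m 1\<^sub>m k - ?c B" if "B \<in> carrier_mat k k" for B k
    using that unfolding char_poly_matrix_def by (intro eq_matI) auto
  have cp_add: "char_poly_matrix (B + C) = char_poly_matrix B - ?c C"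
    if "B \<in> carrier_mat k k" "C \<in> carrier_mat k k" for B C k
    using that unfolding char_poly_matrix_def by (intro eq_matI) auto
  have car: "?c A \<in> carrier_mat m m" "?c P \<in> carrier_mat m n" "?c K \<in> carrier_mat n m"
    "?c E \<in> carrier_mat n n"
    using assms by auto
  have "?c A * ?c P = ?c P * ?c E"
    using AP c.mat_hom_mult[OF A P] c.mat_hom_mult[OF P E] by simp
  moreover have "char_poly_matrix A * ?c P = ?X \<cdot>\<^sub>m ?c P - ?c A * ?c P"
    unfolding cp[OF A] using car by (subst minus_mult_distrib_mat[of _ m m]) auto
  moreover have "?c P * char_poly_matrix E = ?X \<cdot>\<^sub>m ?c P - ?c P * ?c E"
    unfolding cp[OF E] using car by (subst mult_minus_distrib_mat[of _ m n _ n]) auto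
  ultimately have "char_poly_matrix A * ?c P = ?c P * char_poly_matrix E"
    by simp
  from det_diff_intertwined[OF _ car(2,3) _ this] show ?thesis
    using A E unfolding char_poly_def
    by (simp add: cp_add[OF A mult_carrier_mat[OF P K]] cp_add[OF E mult_carrier_mat[OF K P]]
        c.mat_hom_mult[OF P K] c.mat_hom_mult[OF K P])
qed

lemma char_poly_four_block_diag:
  fixes A :: "'a :: idom mat"
  assumes A: "A \<in> carrier_mat m m" and B: "B \<in> carrier_mat n n"
  shows "char_poly (four_block_mat A (0\<^sub>m m n) (0\<^sub>m n m) B) = char_poly A * char_poly B"
proof -
  have "char_poly_matrix (four_block_mat A (0\<^sub>m m n) (0\<^sub>m n m) B) =
      four_block_mat (char_poly_matrix A) (0\<^sub>m m n) (0\<^sub>m n m) (char_poly_matrix B)"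
    unfolding char_poly_matrix_def by (intro eq_matI) (use A B in \<open>auto simp: one_pCons\<close>)
  then show ?thesis
    unfolding char_poly_def
    by simp (rule det_four_block_mat_upper_right_zero[of _ m _ n], use A B in auto)
qed

section \<open>Complex eigenvalues counted with multiplicity\<close>

lemma proots_prod_list_linear:
  "proots (\<Prod>e\<leftarrow>xs. [:- e, 1:]) = mset (xs :: 'a :: idom list)"
  by (induction xs) (simp_all add: proots_mult prod_list_zero_iff image_iff del: mult_pCons_left)

text \<open>Schur triangularization makes \<open>A\<close> similar to an upper triangular
  \<open>T\<close>. The affine map respects both similarity and triangularity, and it acts entrywise
  on the diagonal, where the eigenvalues stand with multiplicity. Nothing is divided by
  \<open>c\<close>, so c = 0 is no special case.\<close>

lemma proots_char_poly_affine:
  fixes A :: "complex mat"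
  assumes A: "A \<in> carrier_mat n n"
  shows "proots (char_poly (a \<cdot>\<^sub>m 1\<^sub>m n + c \<cdot>\<^sub>m A)) =
    image_mset (\<lambda>x. a + c * x) (proots (char_poly A))"
proof -
  obtain es where es: "char_poly A = (\<Prod>e\<leftarrow>es. [:- e, 1:])"
    using char_poly_factorized[OF A] by blast
  obtain T where T: "T \<in> carrier_mat n n" "upper_triangular T" and sim: "similar_mat A T"
    using schur_decomposition_exists[OF A es] by blast
  obtain P Q where wit: "similar_mat_wit A T P Q"
    using sim by (auto simp: similar_mat_def)
  note PQ = similar_mat_witD2(6,7,1-3)[OF A wit]
  let ?f = "\<lambda>B. a \<cdot>\<^sub>m 1\<^sub>m n + c \<cdot>\<^sub>m B"
  have PT: "P * T \<in> carrier_mat n n" using PQ(1) T(1) by simp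
  have "P * ?f T = a \<cdot>\<^sub>m P + c \<cdot>\<^sub>m (P * T)"
    using PQ(1) T(1) by (subst mult_add_distrib_mat[of _ n n _ n]) auto
  then have "P * ?f T * Q = (a \<cdot>\<^sub>m P + c \<cdot>\<^sub>m (P * T)) * Q"
    by simp
  \<comment> \<open>The scalar part becomes \<open>a\<close> times the identity by P Q = 1, and the
    other part becomes \<open>c\<close> times \<open>A\<close> by A = P T Q.\<close>
  also have "\<dots> = ?f A"
    using PQ(1,2) PT PQ(3,5)[symmetric]
    by (simp only: add_mult_distrib_mat[of _ n n _ _ n] smult_carrier_mat mult_smult_assoc_mat[of _ n n _ n])
  finally have "similar_mat (?f A) (?f T)"
    using PQ(1,2) T(1) A by (intro similar_matI[OF _ PQ(3,4)]) auto
  then have "char_poly (?f A) = char_poly (?f T)"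
    by (rule char_poly_similar)
  also have "\<dots> = (\<Prod>e\<leftarrow>diag_mat (?f T). [:- e, 1:])"
    using T by (intro char_poly_upper_triangular[of _ n]) (auto simp: upper_triangular_def)
  also have "diag_mat (?f T) = map (\<lambda>x. a + c * x) (diag_mat T)"
    using T by (auto simp: diag_mat_def)
  finally have "proots (char_poly (?f A)) = image_mset (\<lambda>x. a + c * x) (mset (diag_mat T))"
    by (simp only: proots_prod_list_linear mset_map)
  moreover have "char_poly A = (\<Prod>e\<leftarrow>diag_mat T. [:- e, 1:])"
    using char_poly_similar[OF sim] char_poly_upper_triangular[OF T] by simp
  ultimately show ?thesis
    by (simp only: proots_prod_list_linear)
qed

lemma char_poly_nonzero: "A \<in> carrier_mat n n \<Longrightarrow> char_poly A \<noteq> 0"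
  using degree_monic_char_poly[of A n] by auto

lemma proots_map_poly_of_real_mult:
  assumes "p \<noteq> 0" "q \<noteq> 0"
  shows "proots (map_poly complex_of_real (p * q)) =
    proots (map_poly complex_of_real p) + proots (map_poly complex_of_real q)"
proof -
  interpret map_poly_inj_idom_hom complex_of_real ..
  show ?thesis
    using assms by (simp add: hom_distribs proots_mult)
qed

lemma proots_map_poly_of_real_prod:
  "(\<And>x. x \<in> S \<Longrightarrow> f x \<noteq> 0) \<Longrightarrow> proots (map_poly complex_of_real (\<Prod>x\<in>S. f x)) =
    (\<Sum>x\<in>S. proots (map_poly complex_of_real (f x)))"
  by (induction S rule: infinite_finite_induct) (auto simp: proots_map_poly_of_real_mult)

text \<open>This allows characteristic polynomials to be multiplied and factored over the reals,
  with the passage to complex roots postponed to the very end.\<close>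

lemma eigenvalues_altdef:
  "A \<in> carrier_mat n n \<Longrightarrow> eigenvalues A = proots (map_poly complex_of_real (char_poly A))"
  by (simp add: eigenvalues_def of_real_hom.char_poly_hom)

lemma eigenvalues_affine:
  assumes A: "A \<in> carrier_mat n n"
  shows "eigenvalues (a \<cdot>\<^sub>m 1\<^sub>m n + c \<cdot>\<^sub>m A) =
    image_mset (\<lambda>x. complex_of_real a + complex_of_real c * x) (eigenvalues A)"
proof -
  have "map_mat complex_of_real (a \<cdot>\<^sub>m 1\<^sub>m n + c \<cdot>\<^sub>m A) =
      complex_of_real a \<cdot>\<^sub>m 1\<^sub>m n + complex_of_real c \<cdot>\<^sub>m map_mat complex_of_real A"
    using A by (intro eq_matI) auto
  then show ?thesis
    using A by (simp add: eigenvalues_def proots_char_poly_affine)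
qed

lemma eigenvalues_upper_triangular:
  assumes A: "A \<in> carrier_mat n n" and "upper_triangular A"
  shows "eigenvalues A = mset (map complex_of_real (diag_mat A))"
proof -
  have "diag_mat (map_mat complex_of_real A) = map complex_of_real (diag_mat A)"
    using A by (auto simp: diag_mat_def)
  moreover have "upper_triangular (map_mat complex_of_real A)"
    using assms by (auto simp: upper_triangular_def)
  ultimately show ?thesis
    using A char_poly_upper_triangular[of "map_mat complex_of_real A" n]
    by (simp only: eigenvalues_def map_carrier_mat proots_prod_list_linear)
qed

section \<open>Matrices given by a kernel on enumerated index sets\<close>

text \<open>Rows and columns are addressed by labels instead of positions. Products then become sums
  over sets of vertices or parts, and a change of enumeration leaves the kernel alone.\<close>

definition kernel_mat :: "('a \<Rightarrow> 'b \<Rightarrow> 'c) \<Rightarrow> 'a list \<Rightarrow> 'b list \<Rightarrow> 'c mat" where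
  "kernel_mat f xs ys = mat (length xs) (length ys) (\<lambda>(p, q). f (xs ! p) (ys ! q))"

lemma kernel_mat_carrier [simp]: "kernel_mat f xs ys \<in> carrier_mat (length xs) (length ys)"
  by (simp add: kernel_mat_def)

lemma dim_kernel_mat [simp]:
  "dim_row (kernel_mat f xs ys) = length xs" "dim_col (kernel_mat f xs ys) = length ys"
  by (simp_all add: kernel_mat_def)

lemma index_kernel_mat [simp]:
  "p < length xs \<Longrightarrow> q < length ys \<Longrightarrow> kernel_mat f xs ys $$ (p, q) = f (xs ! p) (ys ! q)"
  by (simp add: kernel_mat_def)

lemma kernel_mat_cong:
  "(\<And>x y. x \<in> set xs \<Longrightarrow> y \<in> set ys \<Longrightarrow> f x y = g x y) \<Longrightarrow> kernel_mat f xs ys = kernel_mat g xs ys"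
  by (intro eq_matI) auto

lemma kernel_mat_add:
  "kernel_mat f xs ys + kernel_mat g xs ys = kernel_mat (\<lambda>x y. f x y + g x y) xs ys"
  by (intro eq_matI) auto

lemma kernel_mat_mult:
  assumes "distinct ys"
  shows "kernel_mat f xs ys * kernel_mat g ys zs =
    kernel_mat (\<lambda>x z. \<Sum>y\<in>set ys. f x y * g y z) xs zs"
proof (intro eq_matI)
  fix p q assume "p < dim_row (kernel_mat (\<lambda>x z. \<Sum>y\<in>set ys. f x y * g y z) xs zs)"
    "q < dim_col (kernel_mat (\<lambda>x z. \<Sum>y\<in>set ys. f x y * g y z) xs zs)"
  then have pq: "p < length xs" "q < length zs" by simp_all
  have "(\<Sum>y\<in>set ys. f (xs ! p) y * g y (zs ! q)) =
      (\<Sum>k = 0..<length ys. f (xs ! p) (ys ! k) * g (ys ! k) (zs ! q))"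
    using assms by (intro sum.reindex_bij_betw[symmetric])
      (simp add: atLeast0LessThan bij_betw_nth)
  with pq show "(kernel_mat f xs ys * kernel_mat g ys zs) $$ (p, q) =
      kernel_mat (\<lambda>x z. \<Sum>y\<in>set ys. f x y * g y z) xs zs $$ (p, q)"
    by (simp add: scalar_prod_def)
qed auto

lemma kernel_mat_one:
  "distinct xs \<Longrightarrow> kernel_mat (\<lambda>x y. of_bool (x = y)) xs xs = 1\<^sub>m (length xs)"
  by (intro eq_matI) (auto simp: nth_eq_iff_index_eq)

text \<open>The kernel of equality between two enumerations of one set is a permutation matrix, and
  exchanging the two lists inverts it. Conjugation by it changes one enumeration into the
  other.\<close>

lemma char_poly_kernel_mat_reorder:
  fixes f :: "'a \<Rightarrow> 'a \<Rightarrow> 'b :: comm_ring_1"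
  assumes "distinct xs" "distinct ys" "set xs = set ys"
  shows "char_poly (kernel_mat f xs xs) = char_poly (kernel_mat f ys ys)"
proof -
  let ?e = "\<lambda>x y. of_bool (x = y) :: 'b"
  have len: "length xs = length ys"
    using assms by (metis distinct_card)
  have delta: "(\<Sum>y\<in>set ys. ?e x y * g y) = g x" if "x \<in> set ys" for x and g :: "'a \<Rightarrow> 'b"
    using that by (subst sum.cong[OF refl, of _ _ "\<lambda>y. if x = y then g y else 0"]) auto
  have delta': "(\<Sum>y\<in>set ys. g y * ?e y x) = g x" if "x \<in> set ys" for x and g :: "'a \<Rightarrow> 'b"
    using that by (subst sum.cong[OF refl, of _ _ "\<lambda>y. if y = x then g y else 0"]) auto
  have "{kernel_mat f xs xs, kernel_mat f ys ys, kernel_mat ?e xs ys, kernel_mat ?e ys xs}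
      \<subseteq> carrier_mat (length xs) (length xs)"
    using kernel_mat_carrier[of f xs xs] kernel_mat_carrier[of f ys ys]
      kernel_mat_carrier[of ?e xs ys] kernel_mat_carrier[of ?e ys xs]
    unfolding len by blast
  moreover have "kernel_mat ?e xs ys * kernel_mat ?e ys xs = kernel_mat ?e xs xs"
    unfolding kernel_mat_mult[OF assms(2)] using assms(3) by (intro kernel_mat_cong) (simp add: delta)
  then have "kernel_mat ?e xs ys * kernel_mat ?e ys xs = 1\<^sub>m (length xs)"
    using kernel_mat_one[OF assms(1)] by metis
  moreover have "kernel_mat ?e ys xs * kernel_mat ?e xs ys = kernel_mat ?e ys ys"
    unfolding kernel_mat_mult[OF assms(1)] using assms(3) by (intro kernel_mat_cong) (simp add: delta)
  then have "kernel_mat ?e ys xs * kernel_mat ?e xs ys = 1\<^sub>m (length xs)"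
    using kernel_mat_one[OF assms(2)] len by metis
  moreover have "kernel_mat f xs xs = kernel_mat ?e xs ys * kernel_mat f ys ys * kernel_mat ?e ys xs"
    unfolding kernel_mat_mult[OF assms(2)] using assms(3)
    by (intro kernel_mat_cong) (simp add: delta delta')
  ultimately show ?thesis
    by (intro char_poly_similar similar_matI)
qed

lemma char_poly_kernel_mat_append:
  fixes f :: "'a \<Rightarrow> 'a \<Rightarrow> 'b :: idom"
  assumes "\<And>x y. x \<in> set xs \<Longrightarrow> y \<in> set ys \<Longrightarrow> f x y = 0 \<and> f y x = 0"
  shows "char_poly (kernel_mat f (xs @ ys) (xs @ ys)) =
    char_poly (kernel_mat f xs xs) * char_poly (kernel_mat f ys ys)"
proof -
  have "kernel_mat f (xs @ ys) (xs @ ys) =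
      four_block_mat (kernel_mat f xs xs) (0\<^sub>m (length xs) (length ys))
        (0\<^sub>m (length ys) (length xs)) (kernel_mat f ys ys)"
    by (intro eq_matI) (auto simp: nth_append assms)
  then show ?thesis
    by (simp add: char_poly_four_block_diag)
qed

lemma char_poly_kernel_mat_concat:
  fixes f :: "'a \<Rightarrow> 'a \<Rightarrow> 'b :: idom"
  assumes "distinct is"
    and "\<And>i j x y. i \<in> set is \<Longrightarrow> j \<in> set is \<Longrightarrow> i \<noteq> j \<Longrightarrow> x \<in> set (xs i) \<Longrightarrow> y \<in> set (xs j) \<Longrightarrow>
      f x y = 0"
  shows "char_poly (kernel_mat f (concat (map xs is)) (concat (map xs is))) =
    (\<Prod>i\<in>set is. char_poly (kernel_mat f (xs i) (xs i)))"
  using assms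
proof (induction "is")
  case Nil
  show ?case by (simp add: char_poly_def det_dim_zero[OF char_poly_matrix_closed[of _ 0]] kernel_mat_def)
next
  case (Cons i "is")
  have "char_poly (kernel_mat f (xs i @ concat (map xs is)) (xs i @ concat (map xs is))) =
      char_poly (kernel_mat f (xs i) (xs i)) *
      char_poly (kernel_mat f (concat (map xs is)) (concat (map xs is)))"
    using Cons.prems by (intro char_poly_kernel_mat_append) auto
  with Cons show ?case by auto
qed

section \<open>Graphs\<close>

lemma adjacency_matrix_kernel_mat:
  "adjacency_matrix G xs = kernel_mat (\<lambda>x y. of_bool ((x, y) \<in> parcs G)) xs xs"
  by (intro eq_matI) (auto simp: adjacency_matrix_def)

lemma out_degree_eq_card_neighbourhood:
  "out_degree (with_proj G) v = card (neighbourhood G v)"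
proof -
  have "out_arcs (with_proj G) v = Pair v ` neighbourhood G v"
    by (auto simp: out_arcs_def neighbourhood_def)
  then show ?thesis
    by (simp add: out_degree_def card_image inj_on_def)
qed

text \<open>The left diagonal factor scales rows and the right one scales columns. Degrees appear as
  cardinalities of neighbourhoods, which is the form in which they are counted for a joined
  union.\<close>

lemma normalized_laplacian_kernel_mat:
  assumes "distinct xs"
  shows "normalized_laplacian G xs = kernel_mat (\<lambda>x y. of_bool (x = y) -
    of_bool ((x, y) \<in> parcs G) / (sqrt (card (neighbourhood G x)) * sqrt (card (neighbourhood G y)))) xs xs"
  (is "_ = ?M")
proof (intro eq_matI)
  let ?D = "inv_sqrt_degree_matrix G xs" and ?A = "adjacency_matrix G xs"
  have A: "?A \<in> carrier_mat (length xs) (length xs)"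
    by (simp add: adjacency_matrix_kernel_mat)
  fix p q assume "p < dim_row ?M" "q < dim_col ?M"
  then have pq: "p < length xs" "q < length xs" by simp_all
  have DA: "?D * ?A = mat (length xs) (length xs)
      (\<lambda>(i, j). 1 / sqrt (card (neighbourhood G (xs ! i))) * ?A $$ (i, j))"
    unfolding inv_sqrt_degree_matrix_def out_degree_eq_card_neighbourhood
    by (rule mat_diag_mult_left[OF A])
  have "?D * ?A * ?D = mat (length xs) (length xs)
      (\<lambda>(i, j). (?D * ?A) $$ (i, j) * (1 / sqrt (card (neighbourhood G (xs ! j)))))"
    unfolding inv_sqrt_degree_matrix_def out_degree_eq_card_neighbourhood
    by (rule mat_diag_mult_right[OF mult_carrier_mat[OF mat_diag_dim A]])
  then show "normalized_laplacian G xs $$ (p, q) = ?M $$ (p, q)"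
    using pq assms unfolding normalized_laplacian_def DA
    by (simp add: adjacency_matrix_kernel_mat nth_eq_iff_index_eq)
qed (simp_all add: normalized_laplacian_def inv_sqrt_degree_matrix_def mat_diag_def)

text \<open>The two pieces yield the two summands of the degree: the first has \<open>r i\<close>
  elements and the second \<open>\<alpha> i\<close>.\<close>

lemma neighbourhood_joined_union:
  assumes G: "pair_graph G" and "i < length vs" and "x \<in> pverts (Gs i)"
  shows "neighbourhood (joined_union G vs Gs) (i, x) =
    Pair i ` neighbourhood (Gs i) x \<union>
    (SIGMA j:{j. j < length vs \<and> vs ! j \<in> neighbourhood G (vs ! i)}. pverts (Gs j))"
  using assms by (auto simp: neighbourhood_def joined_union_def)

lemma pair_graph_irrefl:
  assumes "pair_graph G"
  shows "(v, v) \<notin> parcs G"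
proof -
  interpret pair_graph G by fact
  show ?thesis using pair_no_loops[of "(v, v)"] by auto
qed

section \<open>The spectrum of a joined union\<close>

theorem theorem4p1:
  fixes G :: "'v pair_pre_digraph" and vs :: "'v list" and n :: nat
    and Gs :: "nat \<Rightarrow> 'a pair_pre_digraph" and us :: "nat \<Rightarrow> 'a list"
    and N r \<alpha> :: "nat \<Rightarrow> nat" and lam :: "nat \<Rightarrow> nat \<Rightarrow> real"
    and ws :: "(nat \<times> 'a) list"
  assumes "pair_graph G" and "enumerates vs G" and "n = length vs"
    and "\<And>i. i < n \<Longrightarrow> regular_graph (Gs i) (r i)"
    and "\<And>i. i < n \<Longrightarrow> pverts (Gs i) \<noteq> {}"
    and "\<And>i. i < n \<Longrightarrow> N i = card (pverts (Gs i))"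
    and "\<And>i. i < n \<Longrightarrow> enumerates (us i) (Gs i)"
    and "\<And>i. i < n \<Longrightarrow> eigenvalues (adjacency_matrix (Gs i) (us i)) =
           image_mset (\<lambda>k. complex_of_real (lam i k)) (mset_set {1..N i})"
    and "\<And>i j k. i < n \<Longrightarrow> 1 \<le> j \<Longrightarrow> j \<le> k \<Longrightarrow> k \<le> N i \<Longrightarrow> lam i k \<le> lam i j"
    and "\<And>i. i < n \<Longrightarrow> lam i 1 = real (r i)"
    and "\<And>i. i < n \<Longrightarrow> \<alpha> i = (\<Sum>j | j < n \<and> vs ! j \<in> neighbourhood G (vs ! i). N j)"
    and "\<And>i. i < n \<Longrightarrow> r i + \<alpha> i > 0"
    and "enumerates ws (joined_union G vs Gs)"
  shows "eigenvalues (normalized_laplacian (joined_union G vs Gs) ws) =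
    (\<Sum>i<n. image_mset (\<lambda>k. complex_of_real (1 - lam i k / real (r i + \<alpha> i))) (mset_set {2..N i})) +
    eigenvalues (mat n n (\<lambda>(i, j).
      if i = j then real (\<alpha> i) / real (\<alpha> i + r i)
      else - (real (N j) * adjacency_matrix G vs $$ (i, j) /
                sqrt (real (r i + \<alpha> i) * real (r j + \<alpha> j)))))"
proof -
  let ?J = "joined_union G vs Gs"
  let ?V = "SIGMA i:{..<n}. pverts (Gs i)"
  \<comment> \<open>\<open>d i\<close> is the common degree in \<open>?J\<close> of all vertices of
    part \<open>i\<close>, as \<open>cardJ\<close> confirms. \<open>M\<close> is the normalized
    Laplacian written with these degrees, and \<open>Q\<close> is the kernel of E + K P.\<close>
  define d where "d i = real (r i + \<alpha> i)" for i
  define M where "M u v = of_bool (u = v) - of_bool ((u, v) \<in> parcs ?J) /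
    (sqrt (d (fst u)) * sqrt (d (fst v)))" for u v
  define B where "B u v = (if fst u = fst v then of_bool (snd u = snd v) -
    of_bool ((snd u, snd v) \<in> parcs (Gs (fst u))) / d (fst u) else 0)" for u v
  define P where "P u i = (of_bool (fst u = i) :: real)" for u :: "nat \<times> 'a" and i
  define K where "K i v = - (of_bool ((vs ! i, vs ! fst v) \<in> parcs G) /
    (sqrt (d i) * sqrt (d (fst v))))" for i and v :: "nat \<times> 'a"
  define E where "E i j = (if i = j then \<alpha> i / d i else 0)" for i j
  define Q where "Q i j = E i j - N j * of_bool ((vs ! i, vs ! j) \<in> parcs G) /
    (sqrt (d i) * sqrt (d j))" for i j
  let ?I = "[0..<n]"
  note G = assms(1) and vs = assms(2) and n = assms(3) and us = assms(7)
  have Gs: "pair_graph (Gs i)" and deg: "\<And>x. x \<in> pverts (Gs i) \<Longrightarrow> card (neighbourhood (Gs i) x) = r i"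
    if "i < n" for i
    using assms(4)[OF that] by (auto simp: regular_graph_def out_degree_eq_card_neighbourhood)
  have sub: "parcs (Gs i) \<subseteq> pverts (Gs i) \<times> pverts (Gs i)" if "i < n" for i
  proof -
    interpret pair_graph "Gs i" using Gs[OF that] .
    show ?thesis by (auto dest: in_arcsD1 in_arcsD2)
  qed
  have fin: "finite (pverts (Gs i))" if "i < n" for i
    using us[OF that] by (metis enumerates_def List.finite_set)
  have nbh: "neighbourhood (Gs i) x \<subseteq> pverts (Gs i)" if "i < n" for i x
    using sub[OF that] by (auto simp: neighbourhood_def)
  have N: "N i \<ge> 1" if "i < n" for i
    using assms(5,6)[OF that] fin[OF that] by (simp add: Suc_le_eq card_gt_0_iff)
  have d: "d i > 0" if "i < n" for i
    using assms(12)[OF that] by (simp only: d_def of_nat_0_less_iff)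
  have ws: "distinct ws" "set ws = ?V"
    using assms(13) n by (auto simp: enumerates_def joined_union_def)
  have cardJ: "real (card (neighbourhood ?J u)) = d (fst u)" if "u \<in> ?V" for u
  proof -
    obtain i x where u: "u = (i, x)" "i < n" "x \<in> pverts (Gs i)"
      using \<open>u \<in> ?V\<close> by auto
    let ?S = "{j. j < n \<and> vs ! j \<in> neighbourhood G (vs ! i)}"
    \<comment> \<open>Since \<open>G\<close> has no loops, part \<open>i\<close> is not among its
      own neighbouring parts. This makes the two pieces of the neighbourhood disjoint.\<close>
    have "i \<notin> ?S"
      using pair_graph_irrefl[OF G] by (auto simp: neighbourhood_def)
    then have "Pair i ` neighbourhood (Gs i) x \<inter> (SIGMA j:?S. pverts (Gs j)) = {}"
      by auto
    moreover have "finite (Pair i ` neighbourhood (Gs i) x)"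
      using finite_subset[OF nbh fin] u by blast
    moreover have "finite (SIGMA j:?S. pverts (Gs j))"
      using fin by auto
    ultimately have "card (neighbourhood ?J u) =
        card (Pair i ` neighbourhood (Gs i) x) + card (SIGMA j:?S. pverts (Gs j))"
      unfolding u(1) n using u(2,3) n
      by (subst neighbourhood_joined_union[OF G]) (auto simp only: card_Un_disjoint)
    also have "card (SIGMA j:?S. pverts (Gs j)) = \<alpha> i"
      using assms(6,11) u fin by (subst card_SigmaI) auto
    finally show ?thesis
      using deg u by (simp add: card_image inj_on_def d_def)
  qed
  have L: "normalized_laplacian ?J ws = kernel_mat M ws ws"
    unfolding normalized_laplacian_kernel_mat[OF ws(1)]
    by (intro kernel_mat_cong) (simp add: ws cardJ M_def)
  have MBPK: "kernel_mat M ws ws = kernel_mat B ws ws + kernel_mat P ws ?I * kernel_mat K ?I ws"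
    unfolding kernel_mat_mult[OF distinct_upt] kernel_mat_add
  proof (intro kernel_mat_cong)
    fix u v assume "u \<in> set ws" "v \<in> set ws"
    then obtain i x j y where u: "u = (i, x)" "i < n" "x \<in> pverts (Gs i)"
      and v: "v = (j, y)" "j < n" "y \<in> pverts (Gs j)"
      unfolding ws by auto
    have "(\<Sum>k\<in>set ?I. P u k * K k v) = (\<Sum>k\<in>set ?I. if i = k then K k v else 0)"
      by (intro sum.cong) (auto simp: P_def u)
    also have "\<dots> = K i v"
      using u by simp
    \<comment> \<open>Inside a part, \<open>K\<close> vanishes because \<open>G\<close> has no
      loops, and the two equal square roots multiply to \<open>d i\<close>, giving \<open>B\<close>.
      Between different parts \<open>B\<close> vanishes and only the join term \<open>K\<close>
      remains.\<close>
    finally show "M u v = B u v + (\<Sum>k\<in>set ?I. P u k * K k v)"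
      using u v pair_graph_irrefl[OF G] d[of i] n
      by (auto simp: M_def B_def K_def joined_union_def)
  qed
  \<comment> \<open>An entry of B P is the sum of a row of \<open>B\<close> over one part. Over the
    part of \<open>u\<close> itself, regularity makes this sum 1 - r_i / d_i for every vertex
    \<open>u\<close> of the part; over any other part it is 0.\<close>
  have BP: "kernel_mat B ws ws * kernel_mat P ws ?I = kernel_mat P ws ?I * kernel_mat E ?I ?I"
    unfolding kernel_mat_mult[OF distinct_upt] kernel_mat_mult[OF ws(1)]
  proof (intro kernel_mat_cong)
    fix u j assume "u \<in> set ws" "j \<in> set ?I"
    then obtain i x where u: "u = (i, x)" "i < n" "x \<in> pverts (Gs i)" and j: "j < n"
      unfolding ws by auto
    have "(\<Sum>v\<in>set ws. B u v * P v j) = (\<Sum>k<n. \<Sum>y\<in>pverts (Gs k). B u (k, y) * P (k, y) j)"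
      unfolding ws using fin by (subst sum.Sigma) auto
    also have "\<dots> = (\<Sum>k<n. if k = j then \<Sum>y\<in>pverts (Gs j). B u (j, y) else 0)"
      by (intro sum.cong) (auto simp: P_def)
    also have "\<dots> = (\<Sum>y\<in>pverts (Gs j). B u (j, y))"
      using j by simp
    also have "\<dots> = E i j"
    proof (cases "i = j")
      case True
      have "(\<Sum>y\<in>pverts (Gs j). B u (j, y)) = (\<Sum>y\<in>pverts (Gs i). of_bool (x = y)) -
          (\<Sum>y\<in>pverts (Gs i). of_bool (y \<in> neighbourhood (Gs i) x)) / d i"
        using True by (simp add: B_def u neighbourhood_def sum_subtractf sum_divide_distrib)
      also have "(\<Sum>y\<in>pverts (Gs i). of_bool (x = y)) = (1 :: real)"
        using u fin[of i] by (simp add: of_bool_def)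
      also have "(\<Sum>y\<in>pverts (Gs i). of_bool (y \<in> neighbourhood (Gs i) x)) = real (r i)"
        using u fin[of i] nbh[of i x] deg[of i x]
        by (simp add: sum_of_bool_eq Int_absorb1 Int_def[symmetric])
      also have "1 - real (r i) / d i = E i j"
        using True d[OF u(2)] by (simp add: E_def d_def field_simps)
      finally show ?thesis .
    qed (simp add: B_def E_def u)
    also have "\<dots> = (\<Sum>k\<in>set ?I. if i = k then E k j else 0)"
      using u by simp
    also have "\<dots> = (\<Sum>k\<in>set ?I. P u k * E k j)"
      by (intro sum.cong) (auto simp: P_def u)
    finally show "(\<Sum>v\<in>set ws. B u v * P v j) = (\<Sum>k\<in>set ?I. P u k * E k j)" .
  qed
  \<comment> \<open>\<open>K i (j, y)\<close> does not depend on \<open>y\<close>, so summing over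
    part \<open>j\<close> produces the factor \<open>N j\<close>. This is why the quotient matrix
    need not be symmetric.\<close>
  have EKP: "kernel_mat E ?I ?I + kernel_mat K ?I ws * kernel_mat P ws ?I = kernel_mat Q ?I ?I"
    unfolding kernel_mat_mult[OF ws(1)] kernel_mat_add
  proof (intro kernel_mat_cong)
    fix i j assume "i \<in> set ?I" "j \<in> set ?I"
    then have ij: "i < n" "j < n" by auto
    have "(\<Sum>v\<in>set ws. K i v * P v j) = (\<Sum>k<n. \<Sum>y\<in>pverts (Gs k). K i (k, y) * P (k, y) j)"
      unfolding ws using fin by (subst sum.Sigma) auto
    also have "\<dots> = (\<Sum>k<n. if k = j then \<Sum>y\<in>pverts (Gs j). K i (j, y) else 0)"
      by (intro sum.cong) (auto simp: P_def)
    also have "\<dots> = (\<Sum>y\<in>pverts (Gs j). K i (j, y))"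
      using ij by simp
    finally show "E i j + (\<Sum>v\<in>set ws. K i v * P v j) = Q i j"
      using assms(6) ij by (simp add: K_def Q_def)
  qed
  have Q: "mat n n (\<lambda>(i, j). if i = j then real (\<alpha> i) / real (\<alpha> i + r i)
      else - (real (N j) * adjacency_matrix G vs $$ (i, j) /
                sqrt (real (r i + \<alpha> i) * real (r j + \<alpha> j)))) = kernel_mat Q ?I ?I"
  proof (intro eq_matI)
    fix i j assume "i < dim_row (kernel_mat Q ?I ?I)" "j < dim_col (kernel_mat Q ?I ?I)"
    then have ij: "i < n" "j < n" by simp_all
    have "adjacency_matrix G vs $$ (i, j) = of_bool ((vs ! i, vs ! j) \<in> parcs G)"
      using ij n by (simp add: adjacency_matrix_kernel_mat)
    moreover have "real (\<alpha> i + r i) = d i"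
      by (simp add: d_def)
    ultimately show "mat n n (\<lambda>(i, j). if i = j then real (\<alpha> i) / real (\<alpha> i + r i)
        else - (real (N j) * adjacency_matrix G vs $$ (i, j) /
                sqrt (real (r i + \<alpha> i) * real (r j + \<alpha> j)))) $$ (i, j) = kernel_mat Q ?I ?I $$ (i, j)"
      \<comment> \<open>On the diagonal the join term of \<open>Q\<close> is zero by looplessness;
        off the diagonal \<open>E\<close> is zero and the square root of the product splits.\<close>
      unfolding d_def[symmetric] using ij pair_graph_irrefl[OF G, of "vs ! i"]
      by (cases "i = j") (simp_all only: index_mat index_kernel_mat length_upt nth_upt Q_def E_def
          real_sqrt_mult, simp_all)
  qed simp_all
  have "char_poly (kernel_mat M ws ws) * char_poly (kernel_mat E ?I ?I) =
      char_poly (kernel_mat B ws ws) * char_poly (kernel_mat Q ?I ?I)"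
    using char_poly_add_intertwined[OF kernel_mat_carrier kernel_mat_carrier kernel_mat_carrier
        kernel_mat_carrier BP, of K]
    unfolding MBPK EKP .
  \<comment> \<open>Characteristic polynomials are monic, hence nonzero, so the roots of a product
    are the multiset sum of the roots of its factors.\<close>
  then have "eigenvalues (kernel_mat M ws ws) + eigenvalues (kernel_mat E ?I ?I) =
      eigenvalues (kernel_mat B ws ws) + eigenvalues (kernel_mat Q ?I ?I)"
    by (simp add: eigenvalues_altdef[OF kernel_mat_carrier] char_poly_nonzero[OF kernel_mat_carrier]
        flip: proots_map_poly_of_real_mult)
  moreover have "eigenvalues (kernel_mat E ?I ?I) = (\<Sum>i<n. {#complex_of_real (\<alpha> i / d i)#})"
  proof -
    have "upper_triangular (kernel_mat E ?I ?I)"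
      by (auto simp: upper_triangular_def E_def)
    moreover have "diag_mat (kernel_mat E ?I ?I) = map (\<lambda>i. \<alpha> i / d i) ?I"
      by (auto simp: diag_mat_def E_def)
    ultimately have "eigenvalues (kernel_mat E ?I ?I) =
        mset (map complex_of_real (map (\<lambda>i. \<alpha> i / d i) ?I))"
      using eigenvalues_upper_triangular[OF kernel_mat_carrier] by metis
    also have "\<dots> = (\<Sum>i<n. {#complex_of_real (\<alpha> i / d i)#})"
      by (induction n) auto
    finally show ?thesis .
  qed
  moreover have "eigenvalues (kernel_mat B ws ws) =
      (\<Sum>i<n. image_mset (\<lambda>k. complex_of_real (1 - lam i k / d i)) (mset_set {1..N i}))"
  proof -
    \<comment> \<open>Listing the vertices part by part makes \<open>B\<close> block diagonal,
      whatever the order in \<open>ws\<close>.\<close>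
    let ?xs = "\<lambda>i. map (Pair i) (us i)"
    have us': "distinct (us i)" "set (us i) = pverts (Gs i)" if "i < n" for i
      using us[OF that] by (auto simp: enumerates_def)
    \<comment> \<open>Distinctness of the concatenation requires the lists themselves to differ.
      Their tags ensure this because the parts are nonempty; two empty parts would give the same
      list.\<close>
    have "inj_on ?xs (set ?I)"
      using assms(5) us' by (intro inj_onI) (fastforce dest: arg_cong[of _ _ set])
    then have "distinct (concat (map ?xs ?I))"
      using us' by (intro distinct_concat) (auto simp: distinct_map inj_on_def)
    moreover have "set (concat (map ?xs ?I)) = set ws"
      using us' by (auto simp: ws)
    ultimately have "char_poly (kernel_mat B ws ws) =
        char_poly (kernel_mat B (concat (map ?xs ?I)) (concat (map ?xs ?I)))"
      using ws(1) by (intro char_poly_kernel_mat_reorder) auto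
    also have "\<dots> = (\<Prod>i<n. char_poly (kernel_mat B (?xs i) (?xs i)))"
      by (subst char_poly_kernel_mat_concat) (auto simp: B_def atLeast0LessThan)
    finally have "eigenvalues (kernel_mat B ws ws) =
        (\<Sum>i<n. eigenvalues (kernel_mat B (?xs i) (?xs i)))"
      by (simp add: eigenvalues_altdef[OF kernel_mat_carrier] char_poly_nonzero[OF kernel_mat_carrier]
          proots_map_poly_of_real_prod)
    also have "\<dots> = (\<Sum>i<n. image_mset (\<lambda>k. complex_of_real (1 - lam i k / d i)) (mset_set {1..N i}))"
    proof (intro sum.cong refl)
      fix i assume "i \<in> {..<n}"
      then have i: "i < n" by simp
      \<comment> \<open>Each block is an affine image of the adjacency matrix of its part, so its
        spectrum can be read off from \<open>lam i\<close>.\<close>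
      have "kernel_mat B (?xs i) (?xs i) =
          1 \<cdot>\<^sub>m 1\<^sub>m (length (us i)) + (- 1 / d i) \<cdot>\<^sub>m adjacency_matrix (Gs i) (us i)"
        using us'[OF i]
        by (intro eq_matI) (auto simp: B_def adjacency_matrix_kernel_mat nth_eq_iff_index_eq)
      then have "eigenvalues (kernel_mat B (?xs i) (?xs i)) =
          image_mset (\<lambda>x. complex_of_real 1 + complex_of_real (- 1 / d i) * x)
            (eigenvalues (adjacency_matrix (Gs i) (us i)))"
        by (simp only:) (rule eigenvalues_affine, simp add: adjacency_matrix_kernel_mat)
      then show "eigenvalues (kernel_mat B (?xs i) (?xs i)) =
          image_mset (\<lambda>k. complex_of_real (1 - lam i k / d i)) (mset_set {1..N i})"
        unfolding assms(8)[OF i] by (simp add: image_mset.compositionality o_def)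
    qed
    finally show ?thesis .
  qed
  moreover have "(\<Sum>i<n. image_mset (\<lambda>k. complex_of_real (1 - lam i k / d i)) (mset_set {1..N i})) =
      (\<Sum>i<n. {#complex_of_real (\<alpha> i / d i)#}) +
      (\<Sum>i<n. image_mset (\<lambda>k. complex_of_real (1 - lam i k / d i)) (mset_set {2..N i}))"
    unfolding sum.distrib[symmetric]
  proof (intro sum.cong refl)
    fix i assume "i \<in> {..<n}"
    then have i: "i < n" by simp
    \<comment> \<open>A nonempty part has \<open>N i\<close> at least 1, so the index 1 can be split
      off. It carries the eigenvalue \<open>r i\<close>, whose image is the diagonal entry of
      \<open>E\<close>.\<close>
    have "{1..N i} = insert 1 {2..N i}"
      using N[OF i] by auto
    moreover have "1 - lam i 1 / d i = \<alpha> i / d i"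
      using assms(10)[OF i] d[OF i] by (simp add: d_def field_simps)
    ultimately show "image_mset (\<lambda>k. complex_of_real (1 - lam i k / d i)) (mset_set {1..N i}) =
        {#complex_of_real (\<alpha> i / d i)#} +
        image_mset (\<lambda>k. complex_of_real (1 - lam i k / d i)) (mset_set {2..N i})"
      by (simp del: of_real_diff of_real_divide)
  qed
  \<comment> \<open>The eigenvalues of \<open>E\<close> now occur on both sides and are removed by
    cancellation of multisets.\<close>
  ultimately have "eigenvalues (kernel_mat M ws ws) =
      (\<Sum>i<n. image_mset (\<lambda>k. complex_of_real (1 - lam i k / d i)) (mset_set {2..N i})) +
      eigenvalues (kernel_mat Q ?I ?I)"
    by (simp add: add.assoc add.commute)
  then show ?thesis
    unfolding Q L d_def .
qed

end
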